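(* Assume the Axiom of Choice. Let $X$ and $Y$ be nonempty sets, let $D$ be a nonempty subset of $X^*$, and let $F\colon X^*\to Y$ be a function. The following assertions are equivalent. (i) $F\in\mathcal{P}'_D$. (ii) There exist $H\in\mathcal{A}'_D$ and a one-to-one function $f\colon\mathrm{ran}(H)\to Y$ such that $F=f\circ H$. (iii) There exist $H\in\mathcal{A}'_D$ satisfying $H(D)\subseteq D$ and a one-to-one function $f\colon\mathrm{ran}(H)\to Y$ such that $F=f\circ H$. (iv) There exist $H\in\mathcal{A}'_D$ satisfying $\mathrm{ran}(H)\subseteq X^*$ and $H\circ H=H$ and a one-to-one function $f\colon\mathrm{ran}(H)\to Y$ such that $F=f\circ H$. Moreover, when these assertions hold, for any $g\in Q(F)$ one can choose $H=g\circ F$ and $f=F|_{\mathrm{ran}(H)}$ in assertions (ii) and (iv), and for any $g\in Q_D(F)$ one can choose $H=g\circ F$ and $f=F|_{\mathrm{ran}(H)}$ in assertions (ii) and (iii).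
   Context: For a nonempty set $X$, $X^*=\bigcup_{n\geqslant 0}X^n$ is the set of all finite strings (tuples) over $X$, including the empty string $\varepsilon$ ($X^0=\{\varepsilon\}$), endowed with concatenation, written by juxtaposition, with neutral element $\varepsilon$. $\mathrm{ran}(F)$ and $\mathrm{dom}(F)$ denote the range and domain of $F$; ranges are arbitrary sets (not assumed to be contained in $X^*$). For a nonempty $D\subseteq X^*$: $\mathcal{A}'_D$ is the class of functions $F\colon X^*\to\mathrm{ran}(F)$ such that $F(D)\subseteq X^*$ and $F(\mathbf{x}\mathbf{y}\mathbf{z})=F(\mathbf{x}F(\mathbf{y})\mathbf{z})$ for all $\mathbf{x},\mathbf{y},\mathbf{z}\in X^*$ with $F(\mathbf{y})\in F(D)$. $\mathcal{P}'_D$ is the class of functions $F\colon X^*\to\mathrm{ran}(F)$ such that for all $\mathbf{x},\mathbf{y},\mathbf{y}',\mathbf{z}\in X^*$ with $\mathbf{y}\in D$, $F(\mathbf{y})=F(\mathbf{y}')$ implies $F(\mathbf{x}\mathbf{y}\mathbf{z})=F(\mathbf{x}\mathbf{y}'\mathbf{z})$ (here $\mathbf{y}'$ is not required to lie in $D$). Membership of a function $F\colon X^*\to Y$ in such a class is understood by regarding $F$ as a function onto its range (the codomain plays no role). A function $g$ is a quasi-inverse of a function $f$ if $f\circ g|_{\mathrm{ran}(f)}=\mathrm{id}_{\mathrm{ran}(f)}$ and $\mathrm{ran}(g|_{\mathrm{ran}(f)})=\mathrm{ran}(g)$ (so $\mathrm{ran}(g)\subseteq\mathrm{dom}(f)$).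 $Q(f)$ is the set of quasi-inverses of $f$, and for $D\subseteq\mathrm{dom}(f)$, $Q_D(f)=\{g\in Q(f)\mid (g\circ f)(D)\subseteq D\}$. *)

theory Defs
  imports Main "HOL-Library.FuncSet"
begin

text \<open>
  The set of strings over \<open>X\<close> is \<^term>\<open>lists X\<close>. All functions on strings are functions
  on \<^term>\<open>lists X\<close>; their values elsewhere are never used. So the range of \<open>F\<close> is
  \<open>F ` lists X\<close>.

  A range may mix strings with arbitrary other objects. Functions that need such a range take values
  in \<^typ>\<open>'a list + 'c\<close>: \<^term>\<open>Inl w\<close> is the string \<open>w\<close>, and \<open>'c\<close>, an arbitrary type,
  supplies the values that are not strings.
\<close>

definition class_A' ::
  "'a set \<Rightarrow> 'a list set \<Rightarrow> ('a list \<Rightarrow> 'a list + 'c) set" where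
  "class_A' X D = {F. F ` D \<subseteq> Inl ` lists X \<and>
     (\<forall>x\<in>lists X. \<forall>y\<in>lists X. \<forall>z\<in>lists X.
        F y \<in> F ` D \<longrightarrow> F (x @ y @ z) = F (x @ projl (F y) @ z))}"

definition class_P' :: "'a set \<Rightarrow> 'a list set \<Rightarrow> ('a list \<Rightarrow> 'b) set" where
  "class_P' X D = {F.
     (\<forall>x\<in>lists X. \<forall>y\<in>lists X. \<forall>y'\<in>lists X. \<forall>z\<in>lists X.
        y \<in> D \<longrightarrow> F y = F y' \<longrightarrow> F (x @ y @ z) = F (x @ y' @ z))}"

text \<open>
  Here \<open>f\<close> has domain \<open>A\<close> and \<open>g\<close> has domain \<open>B\<close>. The conditions \<open>f ` A \<subseteq> B\<close> and \<open>g y \<in> A\<close>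
  express that the composition of \<open>f\<close> with the restriction of \<open>g\<close> to the range of \<open>f\<close> is
  defined on all of that range.
\<close>

definition quasi_inverse ::
  "'a set \<Rightarrow> ('a \<Rightarrow> 'b) \<Rightarrow> 'b set \<Rightarrow> ('b \<Rightarrow> 'a) \<Rightarrow> bool" where
  "quasi_inverse A f B g \<longleftrightarrow>
     f ` A \<subseteq> B \<and> (\<forall>y\<in>f ` A. g y \<in> A \<and> f (g y) = y) \<and> g ` (f ` A) = g ` B"

definition quasi_inverse_on ::
  "'a set \<Rightarrow> 'a set \<Rightarrow> ('a \<Rightarrow> 'b) \<Rightarrow> 'b set \<Rightarrow> ('b \<Rightarrow> 'a) \<Rightarrow> bool" where
  "quasi_inverse_on D A f B g \<longleftrightarrow> quasi_inverse A f B g \<and> (g \<circ> f) ` D \<subseteq> D"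

definition factorizes ::
  "'a set \<Rightarrow> 'b set \<Rightarrow> ('a list \<Rightarrow> 'b) \<Rightarrow> ('a list \<Rightarrow> 'c) \<Rightarrow> ('c \<Rightarrow> 'b) \<Rightarrow> bool" where
  "factorizes X Y F H f \<longleftrightarrow>
     f \<in> H ` lists X \<rightarrow> Y \<and> inj_on f (H ` lists X) \<and> (\<forall>w\<in>lists X. F w = f (H w))"

definition assertion_ii ::
  "'a set \<Rightarrow> 'b set \<Rightarrow> 'a list set \<Rightarrow> ('a list \<Rightarrow> 'b) \<Rightarrow>
   ('a list \<Rightarrow> 'a list + 'c) \<Rightarrow> ('a list + 'c \<Rightarrow> 'b) \<Rightarrow> bool" where
  "assertion_ii X Y D F H f \<longleftrightarrow> H \<in> class_A' X D \<and> factorizes X Y F H f"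

definition assertion_iii ::
  "'a set \<Rightarrow> 'b set \<Rightarrow> 'a list set \<Rightarrow> ('a list \<Rightarrow> 'b) \<Rightarrow>
   ('a list \<Rightarrow> 'a list + 'c) \<Rightarrow> ('a list + 'c \<Rightarrow> 'b) \<Rightarrow> bool" where
  "assertion_iii X Y D F H f \<longleftrightarrow>
     H \<in> class_A' X D \<and> H ` D \<subseteq> Inl ` D \<and> factorizes X Y F H f"

definition assertion_iv ::
  "'a set \<Rightarrow> 'b set \<Rightarrow> 'a list set \<Rightarrow> ('a list \<Rightarrow> 'b) \<Rightarrow>
   ('a list \<Rightarrow> 'a list + 'c) \<Rightarrow> ('a list + 'c \<Rightarrow> 'b) \<Rightarrow> bool" where
  "assertion_iv X Y D F H f \<longleftrightarrow>
     H \<in> class_A' X D \<and> H ` lists X \<subseteq> Inl ` lists X \<and>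
     (\<forall>w\<in>lists X. H (projl (H w)) = H w) \<and> factorizes X Y F H f"

end

theory Submission
  imports Defs
begin

text \<open>
  If \<open>F = f \<circ> H\<close> with \<open>f\<close> injective, then \<open>F\<close> and \<open>H\<close> have the same kernel, and the
  associativity of \<open>H\<close> replaces any \<open>y\<close> with \<open>H y \<in> H ` D\<close> by \<open>H y\<close>, which depends only on the
  kernel class of \<open>y\<close>. Conversely, \<open>g \<circ> F\<close> selects a representative of each kernel class of \<open>F\<close>,
  and the substitution property of \<open>F\<close> makes the choice of representative irrelevant. A
  quasi-inverse that selects representatives from \<open>D\<close> whenever possible maps \<open>D\<close> into itself.
\<close>

lemma quasi_inverse_on_exists:
  assumes "D \<subseteq> A"
  shows "\<exists>g. quasi_inverse_on D A f (f ` A) g"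
proof
  \<comment> \<open>Choice enters only through \<open>inv_into\<close>. Taking the range of
    \<open>f\<close> as the domain of \<open>?g\<close> makes the range condition on quasi-inverses
    trivial.\<close>
  let ?g = "\<lambda>y. if y \<in> f ` D then inv_into D f y else inv_into A f y"
  have D: "?g y \<in> D" and fg: "f (?g y) = y" if "y \<in> f ` D" for y
    using that by (simp_all add: inv_into_into f_inv_into_f)
  have "?g y \<in> A \<and> f (?g y) = y" if "y \<in> f ` A" for y
    using that assms D fg by (cases "y \<in> f ` D") (auto simp: inv_into_into f_inv_into_f)
  then show "quasi_inverse_on D A f (f ` A) ?g"
    unfolding quasi_inverse_on_def quasi_inverse_def using D by auto
qed

lemma class_P'_if_assertion_ii:
  assumes "D \<subseteq> lists X" and "assertion_ii X Y D F H f"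
  shows "F \<in> class_P' X D"
  unfolding class_P'_def
proof (intro CollectI ballI impI)
  fix x y y' z
  assume mem: "x \<in> lists X" "y \<in> lists X" "y' \<in> lists X" "z \<in> lists X"
    and D: "y \<in> D" and eq: "F y = F y'"
  have H: "\<And>x y z. \<lbrakk>x \<in> lists X; y \<in> lists X; z \<in> lists X; H y \<in> H ` D\<rbrakk> \<Longrightarrow>
      H (x @ y @ z) = H (x @ projl (H y) @ z)"
    and inj: "inj_on f (H ` lists X)" and F: "\<And>w. w \<in> lists X \<Longrightarrow> F w = f (H w)"
    using assms(2) by (auto simp: assertion_ii_def class_A'_def factorizes_def)
  have Hy: "H y = H y'"
    using eq mem F inj by (auto dest: inj_onD)
  have "H (x @ y @ z) = H (x @ projl (H y) @ z)"
    using H mem D by blast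
  \<comment> \<open>\<open>y'\<close> may lie outside \<open>D\<close>, but
    \<open>H y' = H y\<close> puts its value in the image of \<open>D\<close>, so associativity can
    be used backwards at \<open>y'\<close>.\<close>
  also have "\<dots> = H (x @ y' @ z)"
    using H[of x y' z] mem D Hy by (metis imageI)
  finally have "H (x @ y @ z) = H (x @ y' @ z)" .
  moreover have "x @ y @ z \<in> lists X" "x @ y' @ z \<in> lists X"
    using mem by simp_all
  ultimately show "F (x @ y @ z) = F (x @ y' @ z)"
    using F by metis
qed

text \<open>The class \<open>class_P'\<close> lets two strings be exchanged only if one of them lies
  in \<open>D\<close>, which may fail for both \<open>y\<close> and \<open>g (F y)\<close>. Some
  \<open>d\<close> in \<open>D\<close> with the same value therefore serves as a pivot between
  them.\<close>

lemma class_A'_quasi_inverse_comp: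
  assumes P: "F \<in> class_P' X D" and D: "D \<subseteq> lists X"
    and g: "quasi_inverse (lists X) F B g"
  shows "Inl \<circ> g \<circ> F \<in> class_A' X D"
proof -
  have gX: "g (F w) \<in> lists X" and Fg: "F (g (F w)) = F w" if "w \<in> lists X" for w
    using g that by (auto simp: quasi_inverse_def)
  have sub: "F (x @ y @ z) = F (x @ y' @ z)"
    if "x \<in> lists X" "y \<in> D" "y' \<in> lists X" "z \<in> lists X" "F y = F y'" for x y y' z
    using P D that unfolding class_P'_def by blast
  have "F (x @ y @ z) = F (x @ g (F y) @ z)"
    if mem: "x \<in> lists X" "y \<in> lists X" "z \<in> lists X" and d: "d \<in> D" "g (F y) = g (F d)"
    for x y z d
  proof -
    \<comment> \<open>Applying \<open>F\<close> to \<open>g (F y) = g (F d)\<close> cancels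
      \<open>g\<close>.\<close>
    have "F d = F y"
      using d D mem Fg by (metis subsetD)
    then have "F (x @ d @ z) = F (x @ y @ z)" "F (x @ d @ z) = F (x @ g (F y) @ z)"
      using sub mem d(1) gX Fg by metis+
    then show ?thesis
      by simp
  qed
  then show ?thesis
    unfolding class_A'_def using D gX by force
qed

text \<open>Since \<open>F (g (F w)) = F w\<close>, the map \<open>F\<close> itself, read on
  untagged values of \<open>H g\<close>, recovers \<open>F w\<close>. It is injective there because
  \<open>F w\<close> determines \<open>g (F w)\<close>.\<close>

lemma factorizes_quasi_inverse_comp:
  fixes F :: "'a list \<Rightarrow> 'b"
  defines "H \<equiv> \<lambda>g. (Inl \<circ> g \<circ> F :: 'a list \<Rightarrow> 'a list + 'c)"
  assumes "F \<in> lists X \<rightarrow> Y" and "quasi_inverse (lists X) F B g"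
  shows "factorizes X Y F (H g) (restrict (F \<circ> projl) (H g ` lists X))"
proof -
  have Fg: "F (g (F w)) = F w" and "F w \<in> Y" if "w \<in> lists X" for w
    using assms(2,3) that by (auto simp: quasi_inverse_def)
  moreover have "F v = F w" if "v \<in> lists X" "w \<in> lists X" "g (F v) = g (F w)" for v w
    using Fg that by metis
  ultimately show ?thesis
    unfolding factorizes_def H_def by (force simp: inj_on_def)
qed

text \<open>Idempotence in \<open>assertion_iv\<close> comes down to
  \<open>g (F (g (F w))) = g (F w)\<close>, again by cancelling \<open>F\<close> against
  \<open>g\<close>.\<close>

lemma assertion_ii_iv_quasi_inverse_comp:
  fixes F :: "'a list \<Rightarrow> 'b"
  defines "H \<equiv> \<lambda>g. (Inl \<circ> g \<circ> F :: 'a list \<Rightarrow> 'a list + 'c)"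
  assumes "F \<in> class_P' X D" and "D \<subseteq> lists X" and "F \<in> lists X \<rightarrow> Y"
    and "quasi_inverse (lists X) F B g"
  shows "assertion_ii X Y D F (H g) (restrict (F \<circ> projl) (H g ` lists X))"
    and "assertion_iv X Y D F (H g) (restrict (F \<circ> projl) (H g ` lists X))"
  using class_A'_quasi_inverse_comp[OF assms(2,3,5)] factorizes_quasi_inverse_comp[OF assms(4,5)]
    assms(5)
  unfolding assertion_ii_def assertion_iv_def H_def by (auto simp: quasi_inverse_def)

lemma assertion_iii_quasi_inverse_on_comp:
  fixes F :: "'a list \<Rightarrow> 'b"
  defines "H \<equiv> \<lambda>g. (Inl \<circ> g \<circ> F :: 'a list \<Rightarrow> 'a list + 'c)"
  assumes "F \<in> class_P' X D" and "D \<subseteq> lists X" and "F \<in> lists X \<rightarrow> Y"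
    and "quasi_inverse_on D (lists X) F B g"
  shows "assertion_iii X Y D F (H g) (restrict (F \<circ> projl) (H g ` lists X))"
proof -
  have g: "quasi_inverse (lists X) F B g" and "(g \<circ> F) ` D \<subseteq> D"
    using assms(5) by (simp_all add: quasi_inverse_on_def)
  then show ?thesis
    using class_A'_quasi_inverse_comp[OF assms(2,3) g] factorizes_quasi_inverse_comp[OF assms(4) g]
    unfolding assertion_iii_def H_def by auto
qed

theorem theorem3p8:
  fixes X :: "'a set" and Y :: "'b set" and D :: "'a list set" and F :: "'a list \<Rightarrow> 'b"
  assumes "X \<noteq> {}" and "Y \<noteq> {}" and "D \<noteq> {}" and "D \<subseteq> lists X" and "F \<in> lists X \<rightarrow> Y"
  shows
    "(F \<in> class_P' X D \<longleftrightarrow>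
        (\<exists>(H :: 'a list \<Rightarrow> 'a list + 'c) f. assertion_ii X Y D F H f)) \<and>
     (F \<in> class_P' X D \<longleftrightarrow>
        (\<exists>(H :: 'a list \<Rightarrow> 'a list + 'c) f. assertion_iii X Y D F H f)) \<and>
     (F \<in> class_P' X D \<longleftrightarrow>
        (\<exists>(H :: 'a list \<Rightarrow> 'a list + 'c) f. assertion_iv X Y D F H f)) \<and>
     (F \<in> class_P' X D \<longrightarrow>
        (\<forall>B g. quasi_inverse (lists X) F B g \<longrightarrow>
           (let H = (Inl \<circ> g \<circ> F :: 'a list \<Rightarrow> 'a list + 'c);
                f = restrict (F \<circ> projl) (H ` lists X)
            in assertion_ii X Y D F H f \<and> assertion_iv X Y D F H f)) \<and>
        (\<forall>B g. quasi_inverse_on D (lists X) F B g \<longrightarrow>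
           (let H = (Inl \<circ> g \<circ> F :: 'a list \<Rightarrow> 'a list + 'c);
                f = restrict (F \<circ> projl) (H ` lists X)
            in assertion_ii X Y D F H f \<and> assertion_iii X Y D F H f)))"
proof -
  note choices = assertion_ii_iv_quasi_inverse_comp[OF _ assms(4,5)]
    assertion_iii_quasi_inverse_on_comp[OF _ assms(4,5)]
  \<comment> \<open>A single \<open>g\<close> witnesses all three existence claims, because a
    quasi-inverse preserving \<open>D\<close> is in particular a quasi-inverse.\<close>
  obtain g where g: "quasi_inverse_on D (lists X) F (F ` lists X) g"
    using quasi_inverse_on_exists[OF assms(4)] by blast
  then have g': "quasi_inverse (lists X) F (F ` lists X) g"
    by (simp add: quasi_inverse_on_def)
  have P: "F \<in> class_P' X D" if "assertion_ii X Y D F H f"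
    for H :: "'a list \<Rightarrow> 'a list + 'c" and f
    using class_P'_if_assertion_ii[OF assms(4) that] .
  \<comment> \<open>The other two assertions only strengthen \<open>assertion_ii\<close>, so every
    converse goes through \<open>P\<close>.\<close>
  have "assertion_ii X Y D F H f" if "assertion_iii X Y D F H f \<or> assertion_iv X Y D F H f"
    for H :: "'a list \<Rightarrow> 'a list + 'c" and f
    using that by (auto simp: assertion_ii_def assertion_iii_def assertion_iv_def)
  then have "(F \<in> class_P' X D \<longleftrightarrow>
        (\<exists>(H :: 'a list \<Rightarrow> 'a list + 'c) f. assertion_ii X Y D F H f))"
    "(F \<in> class_P' X D \<longleftrightarrow>
        (\<exists>(H :: 'a list \<Rightarrow> 'a list + 'c) f. assertion_iii X Y D F H f))"
    "(F \<in> class_P' X D \<longleftrightarrow>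
        (\<exists>(H :: 'a list \<Rightarrow> 'a list + 'c) f. assertion_iv X Y D F H f))"
    using P choices(1,2)[OF _ g'] choices(3)[OF _ g] by meson+
  moreover have "quasi_inverse (lists X) F B g" if "quasi_inverse_on D (lists X) F B g" for B g
    using that by (simp add: quasi_inverse_on_def)
  ultimately show ?thesis
    unfolding Let_def by (intro conjI impI allI choices)
qed

end
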